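(* Given an array $A$ of $n$ values, let $T_c$ be the Cartesian tree of $A$. Then the BP sequence of $\tau_4(T_c)$ can be output in $O(n)$ time using $O(\sqrt{n}\log n)$ bits of working space.
   Context: Model: $A[1..n]$ (totally ordered values) is in read-only memory; there is a read-write working memory, and the output is written to a readable, write-once output memory; all memories are randomly accessible (word RAM with word size $\Theta(\log n)$). The Cartesian tree of $A$ is the binary tree whose root is labelled with the index $i$ of the smallest element of $A$, whose left subtree is the Cartesian tree of $A[1..i-1]$ and whose right subtree is the Cartesian tree of $A[i+1..n]$ (the Cartesian tree of an empty array is empty). Transformation $\tau_4$ of a binary tree $T_b$: the ordinal tree (rooted, ordered children) with a dummy root and one node $v(u)$ per node $u$ of $T_b$; if $x_0$ is the root of $T_b$ and $x_{j+1}$ is the left child of $x_j$ up to $x_k$ with no left child, the children of the dummy root are $v(x_k),\dots,v(x_0)$ in this order; for every $u$, the right child of $u$ corresponds to the last child of $v(u)$ and the left child of $u$ corresponds to the previous sibling of $v(u)$. BP sequence of an ordinal tree: in a depth-first traversal (children left to right), write an open parenthesis when a node is first visited and a close parenthesis immediately after all of its descendants have been visited. *)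

theory Defs
  imports Complex_Main "HOL-Library.Tree" "HOL-Library.Landau_Symbols"
begin

section \<open>Cartesian trees\<close>

text \<open>Array positions are counted from 0. Among equal minima the leftmost one is chosen.\<close>

definition min_index :: "'a::linorder list \<Rightarrow> nat \<Rightarrow> nat \<Rightarrow> nat" where
  "min_index A lo hi =
     (LEAST i. i \<in> {lo..<hi} \<and> (\<forall>j\<in>{lo..<hi}. A ! i \<le> A ! j))"

lemma min_index:
  assumes "lo < hi"
  shows "min_index A lo hi \<in> {lo..<hi}"
    and "\<forall>j\<in>{lo..<hi}. A ! min_index A lo hi \<le> A ! j"
proof -
  let ?M = "Min ((!) A ` {lo..<hi})"
  have "?M \<in> (!) A ` {lo..<hi}"
    using assms by (intro Min_in) auto
  then obtain i where "i \<in> {lo..<hi}" "A ! i = ?M" by force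
  then have "i \<in> {lo..<hi} \<and> (\<forall>j\<in>{lo..<hi}. A ! i \<le> A ! j)" by simp
  from LeastI[of "\<lambda>i. i \<in> {lo..<hi} \<and> (\<forall>j\<in>{lo..<hi}. A ! i \<le> A ! j)", OF this]
  show "min_index A lo hi \<in> {lo..<hi}"
    and "\<forall>j\<in>{lo..<hi}. A ! min_index A lo hi \<le> A ! j"
    by (simp_all add: min_index_def)
qed

text \<open>\<open>cartesian A lo hi\<close> is the Cartesian tree of the subarray at positions
  \<open>lo, \<dots>, hi - 1\<close>.\<close>

function cartesian :: "'a::linorder list \<Rightarrow> nat \<Rightarrow> nat \<Rightarrow> nat tree" where
  "cartesian A lo hi =
     (if lo < hi then
        Node (cartesian A lo (min_index A lo hi)) (min_index A lo hi)
             (cartesian A (Suc (min_index A lo hi)) hi)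
      else Leaf)"
  by pat_completeness auto
termination
proof (relation "measure (\<lambda>(A, lo, hi). hi - lo)", goal_cases)
  case 1
  show ?case by simp
next
  case (2 A lo hi)
  then show ?case using min_index(1)[of lo hi A] by auto
next
  case (3 A lo hi)
  then show ?case using min_index(1)[of lo hi A] by auto
qed

declare cartesian.simps [simp del]

definition cartesian_tree :: "'a::linorder list \<Rightarrow> nat tree" where
  "cartesian_tree A = cartesian A 0 (length A)"


section \<open>Ordinal trees, the transformation \<open>\<tau>\<^sub>4\<close>, balanced parentheses\<close>

datatype 'a otree = ONode (olabel: 'a) (ochildren: "'a otree list")

text \<open>\<open>spine_forest T\<close> is the list of sibling nodes formed by the nodes on the left spine of
  \<open>T\<close>, bottom-most first. In \<open>tau4\<close> the label \<open>None\<close> marks the dummy root, and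
  \<open>Some u\<close> is the node \<open>v(u)\<close>.\<close>

fun spine_forest :: "'a tree \<Rightarrow> 'a option otree list" where
  "spine_forest Leaf = []"
| "spine_forest (Node l u r) = spine_forest l @ [ONode (Some u) (spine_forest r)]"

definition tau4 :: "'a tree \<Rightarrow> 'a option otree" where
  "tau4 T = ONode None (spine_forest T)"

fun left_spine :: "'a tree \<Rightarrow> 'a list" where
  "left_spine Leaf = []"
| "left_spine (Node l u r) = u # left_spine l"

lemma children_tau4: "map olabel (ochildren (tau4 T)) = map Some (rev (left_spine T))"
proof -
  have "map olabel (spine_forest T) = map Some (rev (left_spine T))"
    by (induction T) auto
  then show ?thesis by (simp add: tau4_def)
qed

text \<open>\<open>True\<close> is the open and \<open>False\<close> the close parenthesis.\<close>

fun bp :: "'a otree \<Rightarrow> bool list" where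
  "bp (ONode x ts) = True # concat (map bp ts) @ [False]"


section \<open>Word RAM with read-only input and write-once output\<close>

text \<open>The values of the input array form an arbitrary linear order, so they are accessible only
  through comparisons of two addressed entries. An output cell holds one bit.\<close>

datatype binop = Add | Sub | Mul | Div | Mod | BAnd | BOr | BXor | Shl | Shr | Less | Equal

datatype 'r instr =
    Const 'r nat
  | Move 'r 'r
  | Bin binop 'r 'r 'r
  | Load 'r 'r        \<comment> \<open>\<open>Load r a\<close>: \<open>r := work[a]\<close>\<close>
  | Store 'r 'r       \<comment> \<open>\<open>Store a r\<close>: \<open>work[a] := r\<close>\<close>
  | InLess 'r 'r 'r   \<comment> \<open>\<open>InLess r i j\<close>: \<open>r := (A[i] < A[j])\<close>\<close>
  | ReadOut 'r 'r     \<comment> \<open>\<open>ReadOut r a\<close>: \<open>r := output[a]\<close>\<close>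
  | WriteOut 'r 'r    \<comment> \<open>\<open>WriteOut a r\<close>: \<open>output[a] := (r \<noteq> 0)\<close>\<close>
  | Jump nat
  | JumpZero 'r nat
  | Halt

type_synonym prog = "nat instr list"

fun eval_binop :: "nat \<Rightarrow> binop \<Rightarrow> nat \<Rightarrow> nat \<Rightarrow> nat" where
  "eval_binop w Add x y = (x + y) mod 2 ^ w"
| "eval_binop w Sub x y = nat ((int x - int y) mod 2 ^ w)"
| "eval_binop w Mul x y = (x * y) mod 2 ^ w"
| "eval_binop w Div x y = x div y"
| "eval_binop w Mod x y = x mod y"
| "eval_binop w BAnd x y = Bit_Operations.and x y"
| "eval_binop w BOr x y = Bit_Operations.or x y"
| "eval_binop w BXor x y = Bit_Operations.xor x y"
| "eval_binop w Shl x y = (x * 2 ^ y) mod 2 ^ w"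
| "eval_binop w Shr x y = x div 2 ^ y"
| "eval_binop w Less x y = of_bool (x < y)"
| "eval_binop w Equal x y = of_bool (x = y)"

text \<open>\<open>cells\<close> is one more than the largest working-memory address accessed so far. An output
  cell is \<open>None\<close> as long as it has not been written.\<close>

record config =
  pc :: nat
  regs :: "nat \<Rightarrow> nat"
  work :: "nat \<Rightarrow> nat"
  cells :: nat
  outp :: "nat \<Rightarrow> bool option"

definition set_reg :: "nat \<Rightarrow> nat \<Rightarrow> config \<Rightarrow> config" where
  "set_reg r x c = c\<lparr>regs := (regs c)(r := x), pc := Suc (pc c)\<rparr>"

text \<open>The result \<open>None\<close> means that the machine is stuck: input access out of bounds,
  reading an unwritten output cell, or writing an output cell a second time.\<close>

fun exec_instr :: "nat \<Rightarrow> 'a::linorder list \<Rightarrow> nat instr \<Rightarrow> config \<Rightarrow> config option" where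
  "exec_instr w A (Const r k) c = Some (set_reg r (k mod 2 ^ w) c)"
| "exec_instr w A (Move r s) c = Some (set_reg r (regs c s) c)"
| "exec_instr w A (Bin f r s t) c = Some (set_reg r (eval_binop w f (regs c s) (regs c t)) c)"
| "exec_instr w A (Load r a) c =
     Some (set_reg r (work c (regs c a)) (c\<lparr>cells := max (cells c) (Suc (regs c a))\<rparr>))"
| "exec_instr w A (Store a r) c =
     Some (c\<lparr>work := (work c)(regs c a := regs c r),
             cells := max (cells c) (Suc (regs c a)), pc := Suc (pc c)\<rparr>)"
| "exec_instr w A (InLess r i j) c =
     (if regs c i < length A \<and> regs c j < length A
      then Some (set_reg r (of_bool (A ! regs c i < A ! regs c j)) c) else None)"
| "exec_instr w A (ReadOut r a) c =
     (case outp c (regs c a) of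
        None \<Rightarrow> None
      | Some b \<Rightarrow> Some (set_reg r (of_bool b) c))"
| "exec_instr w A (WriteOut a r) c =
     (case outp c (regs c a) of
        None \<Rightarrow> Some (c\<lparr>outp := (outp c)(regs c a := Some (regs c r \<noteq> 0)), pc := Suc (pc c)\<rparr>)
      | Some b \<Rightarrow> None)"
| "exec_instr w A (Jump l) c = Some (c\<lparr>pc := l\<rparr>)"
| "exec_instr w A (JumpZero r l) c = Some (c\<lparr>pc := (if regs c r = 0 then l else Suc (pc c))\<rparr>)"
| "exec_instr w A Halt c = None"

definition step :: "nat \<Rightarrow> prog \<Rightarrow> 'a::linorder list \<Rightarrow> config \<Rightarrow> config \<Rightarrow> bool" where
  "step w P A c c' \<longleftrightarrow> pc c < length P \<and> exec_instr w A (P ! pc c) c = Some c'"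

definition init_config :: "nat \<Rightarrow> config" where
  "init_config n =
     \<lparr>pc = 0, regs = (\<lambda>_. 0)(0 := n), work = (\<lambda>_. 0), cells = 0, outp = (\<lambda>_. None)\<rparr>"

definition halted :: "prog \<Rightarrow> config \<Rightarrow> bool" where
  "halted P c \<longleftrightarrow> pc c < length P \<and> P ! pc c = Halt"

definition registers :: "prog \<Rightarrow> nat set" where
  "registers P = (\<Union>i\<in>set P. set_instr i)"

text \<open>Working space in bits: every register of the program and every working-memory cell up to
  the largest address accessed is charged with a full word.\<close>

definition space_bits :: "nat \<Rightarrow> prog \<Rightarrow> config \<Rightarrow> nat" where
  "space_bits w P c = (card (registers P) + cells c) * w"

text \<open>\<open>computes w P A xs t s\<close>: with word size \<open>w\<close>, the program \<open>P\<close> halts on input \<open>A\<close>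
  after \<open>t\<close> instructions, using \<open>s\<close> bits of working space, and its output memory then contains
  exactly the sequence \<open>xs\<close>.\<close>

definition computes ::
  "nat \<Rightarrow> prog \<Rightarrow> 'a::linorder list \<Rightarrow> bool list \<Rightarrow> nat \<Rightarrow> nat \<Rightarrow> bool" where
  "computes w P A xs t s \<longleftrightarrow>
     (\<exists>c. (step w P A ^^ t) (init_config (length A)) c \<and> halted P c \<and>
          outp c = (\<lambda>k. if k < length xs then Some (xs ! k) else None) \<and>
          s = space_bits w P c)"

text \<open>Word size \<open>\<Theta>(log n)\<close>, where a word must be able to address each of the
  \<open>2n + 2\<close> cells of the output (the length of the parenthesis sequence of \<open>n + 1\<close> nodes).\<close>

definition word_size :: "(nat \<Rightarrow> nat) \<Rightarrow> bool" where
  "word_size w \<longleftrightarrow>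
     (\<lambda>n. real (w n)) \<in> \<Theta>(\<lambda>n. log 2 (real n)) \<and> (\<forall>n. 2 * n + 2 \<le> 2 ^ w n)"

end

theory Submission
  imports Defs
begin

text \<open>Scanning the array from left to right with the usual stack of positions, a push writes an
  open and a pop a close parenthesis, because the right subtree of \<open>i\<close> ends just before the first
  later position with a smaller value. To save space, the positions are cut into blocks of length
  \<open>B \<approx> \<surd>n\<close>. The stack entries in the current block are stored explicitly, but of each
  finished block only the topmost entry \<open>t\<close> is kept: nothing is pushed into that block any more, so
  the entry below \<open>t\<close> is found by scanning the input leftwards from \<open>t\<close> for a value not exceeding
  that of \<open>t\<close>. All scans of a block together visit each of its positions at most once, so the time
  is linear, and at most \<open>n div B + B\<close> cells are used.\<close>

section \<open>The stack algorithm\<close>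

text \<open>Popping needs a strictly smaller value, since ties go to the leftmost minimum. The
  \<open>Suc\<close> in the base case closes the dummy root, which the initial output
  \<open>[True]\<close> opens.\<close>

fun stack_bp :: "'a::linorder list \<Rightarrow> nat list \<Rightarrow> bool list \<Rightarrow> nat list \<Rightarrow> bool list" where
  "stack_bp A [] out s = out @ replicate (Suc (length s)) False"
| "stack_bp A (j # js) out [] = stack_bp A js (out @ [True]) [j]"
| "stack_bp A (j # js) out (x # s) =
     (if A ! j < A ! x then stack_bp A (j # js) (out @ [False]) s
      else stack_bp A js (out @ [True]) (j # x # s))"

text \<open>An earlier position with an equal value would itself be a candidate for
  \<open>LEAST\<close>. Strictness ensures that the minimum pops all entries of its left
  part.\<close>

lemma min_index_least:
  assumes "lo < hi" "j \<in> {lo..<min_index A lo hi}"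
  shows "A ! min_index A lo hi < A ! j"
proof (rule ccontr)
  assume neg: "\<not> A ! min_index A lo hi < A ! j"
  have "j \<in> {lo..<hi} \<and> (\<forall>k\<in>{lo..<hi}. A ! j \<le> A ! k)"
    using assms min_index[OF assms(1), of A] neg by (fastforce simp: not_less)
  then have "min_index A lo hi \<le> j"
    unfolding min_index_def by (rule Least_le)
  with assms(2) show False by simp
qed

lemma stack_bp_pop_all:
  assumes "\<forall>x\<in>set R. A ! j < A ! x" "s = [] \<or> A ! hd s \<le> A ! j"
  shows "stack_bp A (j # js) out (R @ s) =
    stack_bp A js (out @ replicate (length R) False @ [True]) (j # s)"
  using assms
proof (induction R arbitrary: out)
  case Nil
  then show ?case by (cases s) auto
next
  case (Cons x R)
  then show ?case by simp
qed

text \<open>Induction along the tree recursion. The witness \<open>R\<close> is the right spine,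
  whose nodes are still open, so their closes are missing from \<open>out'\<close>. The entries in
  \<open>s\<close> survive because no value of the segment is smaller.\<close>

lemma stack_bp_segment:
  assumes "\<forall>x\<in>set s. \<forall>j\<in>{lo..<hi}. A ! x \<le> A ! j"
  shows "\<exists>R out'. set R \<subseteq> {lo..<hi} \<and>
    out' @ replicate (length R) False = concat (map bp (spine_forest (cartesian A lo hi))) \<and>
    stack_bp A ([lo..<hi] @ js) out s = stack_bp A js (out @ out') (R @ s)"
  using assms
proof (induction A lo hi arbitrary: s js out rule: cartesian.induct)
  case (1 A lo hi)
  show ?case
  proof (cases "lo < hi")
    case False
    then show ?thesis
      by (intro exI[of _ "[]"]) (simp add: cartesian.simps)
  next
    case True
    define m where "m = min_index A lo hi"
    have m: "lo \<le> m" "m < hi" and min: "\<And>j. j \<in> {lo..<hi} \<Longrightarrow> A ! m \<le> A ! j"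
      and least: "\<And>j. j \<in> {lo..<m} \<Longrightarrow> A ! m < A ! j"
      using min_index[OF True, of A] min_index_least[OF True, of _ A] by (auto simp: m_def)
    have split: "[lo..<hi] = [lo..<m] @ m # [Suc m..<hi]"
      using m upt_add_eq_append[of lo m "hi - m"] by (simp add: upt_conv_Cons)
    have tree: "cartesian A lo hi = Node (cartesian A lo m) m (cartesian A (Suc m) hi)"
      using True by (subst cartesian.simps) (simp add: m_def)
    obtain R1 o1 where 1: "set R1 \<subseteq> {lo..<m}"
      "o1 @ replicate (length R1) False = concat (map bp (spine_forest (cartesian A lo m)))"
      "stack_bp A ([lo..<m] @ m # [Suc m..<hi] @ js) out s =
       stack_bp A (m # [Suc m..<hi] @ js) (out @ o1) (R1 @ s)"
      using "1.IH"(1)[OF True, of s "m # [Suc m..<hi] @ js" out] "1.prems" m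
      unfolding m_def[symmetric] by force
    \<comment> \<open>The minimum pops exactly \<open>R1\<close>, which writes the closes still
      missing from the left subtree.\<close>
    have 2: "stack_bp A (m # [Suc m..<hi] @ js) (out @ o1) (R1 @ s) =
      stack_bp A ([Suc m..<hi] @ js) ((out @ o1) @ replicate (length R1) False @ [True]) (m # s)"
    proof (rule stack_bp_pop_all)
      show "\<forall>x\<in>set R1. A ! m < A ! x" using 1(1) least by auto
      show "s = [] \<or> A ! hd s \<le> A ! m" using m "1.prems" by (cases s) auto
    qed
    obtain R2 o2 where 3: "set R2 \<subseteq> {Suc m..<hi}"
      "o2 @ replicate (length R2) False = concat (map bp (spine_forest (cartesian A (Suc m) hi)))"
      "stack_bp A ([Suc m..<hi] @ js) ((out @ o1) @ replicate (length R1) False @ [True]) (m # s)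
       = stack_bp A js (((out @ o1) @ replicate (length R1) False @ [True]) @ o2) (R2 @ m # s)"
      using "1.IH"(2)[OF True, of "m # s" js "(out @ o1) @ replicate (length R1) False @ [True]"]
        "1.prems" m min unfolding m_def[symmetric] by force
    show ?thesis
    proof (intro exI conjI)
      \<comment> \<open>The node of \<open>m\<close> stays open during its right subtree, so
        \<open>m\<close> lies pending below \<open>R2\<close>.\<close>
      show "set (R2 @ [m]) \<subseteq> {lo..<hi}" using 3(1) m by auto
      show "(o1 @ replicate (length R1) False @ [True] @ o2) @ replicate (length (R2 @ [m])) False
        = concat (map bp (spine_forest (cartesian A lo hi)))"
        using 1(2) 3(2) by (simp add: tree replicate_append_same[symmetric])
      show "stack_bp A ([lo..<hi] @ js) out s = stack_bp A js
        (out @ o1 @ replicate (length R1) False @ [True] @ o2) ((R2 @ [m]) @ s)"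
        using 1(3) 2 3(3) by (simp add: split)
    qed
  qed
qed

lemma stack_bp_eq_bp:
  "stack_bp A [0..<length A] [True] [] = bp (tau4 (cartesian_tree A))"
  using stack_bp_segment[of "[]" 0 "length A" A "[]" "[True]"]
  by (auto simp: tau4_def cartesian_tree_def replicate_append_same[symmetric])

text \<open>Below a stack entry \<open>x\<close> lies the nearest position to the left of \<open>x\<close> whose value does not
  exceed that of \<open>x\<close>. Hence a pop can be carried out by scanning the input.\<close>

fun chain :: "'a::linorder list \<Rightarrow> nat list \<Rightarrow> bool" where
  "chain A [] \<longleftrightarrow> True"
| "chain A (x # s) \<longleftrightarrow> chain A s \<and> (\<forall>y\<in>set s. y < x \<and> A ! y \<le> A ! x) \<and>
     (\<forall>i<x. (\<forall>y\<in>set s. y < i) \<longrightarrow> A ! x < A ! i)"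

lemma chain_appendD: "chain A (xs @ ys) \<Longrightarrow> chain A ys"
  by (induction xs) auto

lemma chain_distinct: "chain A s \<Longrightarrow> distinct s"
  by (induction s) auto

text \<open>The top of a chain carries its largest value, so comparing with \<open>hd s\<close> is
  enough.\<close>

lemma chain_push:
  assumes "chain A s" "s = [] \<or> \<not> A ! j < A ! hd s" "\<forall>y\<in>set s. y < j"
    "\<forall>i<j. (\<forall>y\<in>set s. y < i) \<longrightarrow> A ! j < A ! i"
  shows "chain A (j # s)"
  using assms by (cases s) (auto intro: order_trans)

text \<open>If \<open>k\<close> were above all of \<open>s\<close>, the chain property would give
  \<open>A ! x < A ! k\<close>. So the head of \<open>s\<close> is at least \<open>k\<close>, and it
  is not strictly between \<open>k\<close> and \<open>x\<close>, where all values exceed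
  \<open>A ! x\<close>.\<close>

lemma chain_scan_found:
  assumes "chain A (x # s)" "k < x" "\<not> A ! x < A ! k" "\<forall>i\<in>{k<..<x}. A ! x < A ! i"
  shows "\<exists>s'. s = k # s'"
proof (cases s)
  case Nil
  then show ?thesis using assms by auto
next
  case (Cons y s')
  have s: "\<forall>z\<in>set s'. z < y" and y: "y < x" "A ! y \<le> A ! x"
    using assms(1) by (auto simp: Cons)
  have "\<not> (\<forall>z\<in>set s. z < k)"
    using assms(1-3) by (simp only: chain.simps) blast
  then have "k \<le> y" using s by (force simp: Cons)
  moreover have "\<not> k < y"
    using assms(4) y by (meson greaterThanLessThan_iff leD)
  ultimately show ?thesis using Cons by auto
qed

section \<open>Compressing the finished blocks of the stack\<close>

text \<open>Comparing with the head of the recursive result suffices, because in a stack of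
  decreasing positions the entries of one block are adjacent.\<close>

fun block_tops :: "nat \<Rightarrow> nat list \<Rightarrow> nat list" where
  "block_tops B [] = []"
| "block_tops B (x # s) = x # (case block_tops B s of [] \<Rightarrow> []
     | y # r \<Rightarrow> if y div B = x div B then r else y # r)"

lemma block_tops_new_block:
  "\<forall>y\<in>set s. y div B \<noteq> x div B \<Longrightarrow> block_tops B (x # s) = x # block_tops B s"
  by (cases s) auto

lemma block_tops_append:
  assumes "xs \<noteq> []" "\<forall>x\<in>set xs. x div B = b" "\<forall>y\<in>set ys. y div B \<noteq> b"
  shows "block_tops B (xs @ ys) = hd xs # block_tops B ys"
  using assms
proof (induction xs rule: list_nonempty_induct)
  case (single x)
  then show ?case using block_tops_new_block[of ys B x] by simp
next
  case (cons x xs)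
  then show ?case by (cases xs) auto
qed

text \<open>Positions decrease down the stack, so the kept entries lie in distinct blocks.
  \<open>b\<close> varies in the induction because below a change of block only smaller block
  numbers remain.\<close>

lemma length_block_tops_le:
  assumes "chain A s" "\<forall>x\<in>set s. x div B < b"
  shows "length (block_tops B s) \<le> b"
  using assms
proof (induction s arbitrary: b)
  case Nil
  then show ?case by simp
next
  case (Cons x s)
  show ?case
  proof (cases s)
    case Nil
    then show ?thesis using Cons.prems by auto
  next
    case (Cons y s')
    have yx: "y div B \<le> x div B" and zy: "\<And>z. z \<in> set s \<Longrightarrow> z div B \<le> y div B"
      using Cons.prems(1) Cons by (auto intro: div_le_mono less_imp_le)
    show ?thesis
    proof (cases "y div B = x div B")
      case True
      have "length (block_tops B s) \<le> b"
        using Cons.prems by (intro Cons.IH) auto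
      then show ?thesis using True \<open>s = y # s'\<close> by simp
    next
      case False
      have "length (block_tops B s) \<le> x div B"
        using Cons.prems(1) yx zy False by (intro Cons.IH) (auto dest!: zy)
      then show ?thesis using False \<open>s = y # s'\<close> Cons.prems by simp
    qed
  qed
qed

section \<open>The program\<close>

text \<open>A functional form of iterated \<open>step\<close>, so that a fixed number of
  instructions can be evaluated by rewriting.\<close>

fun run :: "nat \<Rightarrow> prog \<Rightarrow> 'a::linorder list \<Rightarrow> nat \<Rightarrow> config \<Rightarrow> config option" where
  "run w P A 0 c = Some c"
| "run w P A (Suc m) c = (if pc c < length P
     then (case exec_instr w A (P ! pc c) c of None \<Rightarrow> None | Some c' \<Rightarrow> run w P A m c')
     else None)"

lemma run_numeral:
  "run w P A (numeral m) c = (if pc c < length P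
     then (case exec_instr w A (P ! pc c) c of None \<Rightarrow> None
           | Some c' \<Rightarrow> run w P A (pred_numeral m) c')
     else None)"
  by (simp add: numeral_eq_Suc)

text \<open>\<open>k\<close> acts as a time budget: segments are chained in front of one another,
  each spending part of it.\<close>

definition reaches_within ::
  "nat \<Rightarrow> prog \<Rightarrow> 'a::linorder list \<Rightarrow> nat \<Rightarrow> config \<Rightarrow> (config \<Rightarrow> bool) \<Rightarrow> bool" where
  "reaches_within w P A k c Q \<longleftrightarrow> (\<exists>t\<le>k. \<exists>c'. (step w P A ^^ t) c c' \<and> Q c')"

lemma run_imp_step: "run w P A m c = Some c' \<Longrightarrow> (step w P A ^^ m) c c'"
proof (induction m arbitrary: c)
  case 0
  then show ?case by simp
next
  case (Suc m)
  from Suc.prems obtain d where "step w P A c d" "run w P A m d = Some c'"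
    by (auto simp: step_def split: if_splits option.splits)
  then show ?case using Suc.IH by (meson relpowp_Suc_I2)
qed

lemma reaches_within_refl: "Q c \<Longrightarrow> reaches_within w P A k c Q"
  unfolding reaches_within_def by (metis le0 relpowp_0_I)

lemma reaches_within_run:
  assumes "run w P A m c = Some c'" "reaches_within w P A k c' Q" "m + k \<le> K"
  shows "reaches_within w P A K c Q"
proof -
  obtain t d where t: "t \<le> k" "(step w P A ^^ t) c' d" "Q d"
    using assms(2) by (auto simp: reaches_within_def)
  have "(step w P A ^^ (m + t)) c d"
    using run_imp_step[OF assms(1)] t(2) by (auto simp: relpowp_add)
  then show ?thesis
    using t assms(3) unfolding reaches_within_def by (intro exI[of _ "m + t"]) auto
qed

lemma reaches_within_weaken:
  "reaches_within w P A k c Q \<Longrightarrow> (\<And>c'. Q c' \<Longrightarrow> Q' c') \<Longrightarrow> reaches_within w P A k c Q'"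
  unfolding reaches_within_def by blast

text \<open>Registers: 0 holds \<open>n\<close>, 1 the constant 1, 2 the block length \<open>B\<close>, 3 the current input
  position \<open>j\<close>, 4 the length of the output, 5 the height of the stored stack, 6 the number of its
  entries that belong to finished blocks, 10 the last output position \<open>2n + 1\<close>, 11 the
  constant 0; 7 and 8 are the stack top and the scanning position, 12 the address of the stack
  top, and 9 is scratch.\<close>

definition cartesian_prog :: prog where
  "cartesian_prog = [
    Const 1 1,
    Const 2 1,
    \<comment> \<open>2: least \<open>B \<ge> 1\<close> with \<open>n \<le> B\<^sup>2\<close>\<close>
    Bin Mul 9 2 2,
    Bin Less 9 9 0,
    JumpZero 9 7,
    Bin Add 2 2 1,
    Jump 2,
    Bin Add 10 0 0,
    Bin Add 10 10 1,
    WriteOut 4 1,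
    Bin Add 4 4 1,
    \<comment> \<open>11: main loop\<close>
    Bin Less 9 3 0,
    JumpZero 9 49,
    \<comment> \<open>13: pop while \<open>A[j] < A[top]\<close>\<close>
    JumpZero 5 36,
    Bin Sub 12 5 1,
    Load 7 12,
    InLess 9 3 7,
    JumpZero 9 36,
    WriteOut 4 11,
    Bin Add 4 4 1,
    Bin Less 9 6 5,
    JumpZero 9 24,
    Move 5 12,
    Jump 13,
    Move 8 7,
    \<comment> \<open>25: scan a finished block for the entry below the top\<close>
    Bin Mod 9 8 2,
    JumpZero 9 33,
    Bin Sub 8 8 1,
    InLess 9 7 8,
    JumpZero 9 31,
    Jump 25,
    Store 12 8,
    Jump 13,
    \<comment> \<open>33: the finished block has become empty\<close>
    Move 5 12,
    Move 6 12,
    Jump 13,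
    \<comment> \<open>36: push \<open>j\<close>\<close>
    Store 5 3,
    Bin Add 5 5 1,
    WriteOut 4 1,
    Bin Add 4 4 1,
    Bin Add 3 3 1,
    Bin Mod 9 3 2,
    JumpZero 9 44,
    Jump 11,
    \<comment> \<open>44: the current block is finished, keep only its top\<close>
    Bin Sub 9 3 1,
    Store 6 9,
    Bin Add 6 6 1,
    Move 5 6,
    Jump 11,
    \<comment> \<open>49: all remaining parentheses are closing\<close>
    WriteOut 4 11,
    Bin Less 9 4 10,
    JumpZero 9 54,
    Bin Add 4 4 1,
    Jump 49,
    Halt]"

lemma length_cartesian_prog: "length cartesian_prog = 55"
  by (simp add: cartesian_prog_def)

lemma cartesian_prog_nth:
  "cartesian_prog ! 0 = Const 1 1"
  "cartesian_prog ! Suc 0 = Const 2 1"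
  "cartesian_prog ! 2 = Bin Mul 9 2 2"
  "cartesian_prog ! 3 = Bin Less 9 9 0"
  "cartesian_prog ! 4 = JumpZero 9 7"
  "cartesian_prog ! 5 = Bin Add 2 2 1"
  "cartesian_prog ! 6 = Jump 2"
  "cartesian_prog ! 7 = Bin Add 10 0 0"
  "cartesian_prog ! 8 = Bin Add 10 10 1"
  "cartesian_prog ! 9 = WriteOut 4 1"
  "cartesian_prog ! 10 = Bin Add 4 4 1"
  "cartesian_prog ! 11 = Bin Less 9 3 0"
  "cartesian_prog ! 12 = JumpZero 9 49"
  "cartesian_prog ! 13 = JumpZero 5 36"
  "cartesian_prog ! 14 = Bin Sub 12 5 1"
  "cartesian_prog ! 15 = Load 7 12"
  "cartesian_prog ! 16 = InLess 9 3 7"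
  "cartesian_prog ! 17 = JumpZero 9 36"
  "cartesian_prog ! 18 = WriteOut 4 11"
  "cartesian_prog ! 19 = Bin Add 4 4 1"
  "cartesian_prog ! 20 = Bin Less 9 6 5"
  "cartesian_prog ! 21 = JumpZero 9 24"
  "cartesian_prog ! 22 = Move 5 12"
  "cartesian_prog ! 23 = Jump 13"
  "cartesian_prog ! 24 = Move 8 7"
  "cartesian_prog ! 25 = Bin Mod 9 8 2"
  "cartesian_prog ! 26 = JumpZero 9 33"
  "cartesian_prog ! 27 = Bin Sub 8 8 1"
  "cartesian_prog ! 28 = InLess 9 7 8"
  "cartesian_prog ! 29 = JumpZero 9 31"
  "cartesian_prog ! 30 = Jump 25"
  "cartesian_prog ! 31 = Store 12 8"
  "cartesian_prog ! 32 = Jump 13"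
  "cartesian_prog ! 33 = Move 5 12"
  "cartesian_prog ! 34 = Move 6 12"
  "cartesian_prog ! 35 = Jump 13"
  "cartesian_prog ! 36 = Store 5 3"
  "cartesian_prog ! 37 = Bin Add 5 5 1"
  "cartesian_prog ! 38 = WriteOut 4 1"
  "cartesian_prog ! 39 = Bin Add 4 4 1"
  "cartesian_prog ! 40 = Bin Add 3 3 1"
  "cartesian_prog ! 41 = Bin Mod 9 3 2"
  "cartesian_prog ! 42 = JumpZero 9 44"
  "cartesian_prog ! 43 = Jump 11"
  "cartesian_prog ! 44 = Bin Sub 9 3 1"
  "cartesian_prog ! 45 = Store 6 9"
  "cartesian_prog ! 46 = Bin Add 6 6 1"
  "cartesian_prog ! 47 = Move 5 6"
  "cartesian_prog ! 48 = Jump 11"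
  "cartesian_prog ! 49 = WriteOut 4 11"
  "cartesian_prog ! 50 = Bin Less 9 4 10"
  "cartesian_prog ! 51 = JumpZero 9 54"
  "cartesian_prog ! 52 = Bin Add 4 4 1"
  "cartesian_prog ! 53 = Jump 49"
  "cartesian_prog ! 54 = Halt"
  by (simp_all add: cartesian_prog_def)

section \<open>Effect of the program segments\<close>

definition stored :: "bool list \<Rightarrow> nat \<Rightarrow> bool option" where
  "stored xs = (\<lambda>k. if k < length xs then Some (xs ! k) else None)"

lemma stored_length: "stored xs (length xs) = None"
  by (simp add: stored_def)

lemma stored_snoc: "(stored xs)(length xs := Some b) = stored (xs @ [b])"
  by (auto simp: stored_def nth_append)

text \<open>The sums and differences formed by the program never overflow, so ordinary arithmetic
  replaces the modular one.\<close>

lemma eval_Add: "x + y < 2 ^ w \<Longrightarrow> eval_binop w Add x y = x + y"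
  by simp

lemma eval_Sub: "y \<le> x \<Longrightarrow> x < 2 ^ w \<Longrightarrow> eval_binop w Sub x y = x - y"
proof -
  assume "y \<le> x" "x < 2 ^ w"
  then have "int x - int y = int (x - y)" "x - y < 2 ^ w" by auto
  then show ?thesis by (simp flip: of_nat_diff add: nat_mod_distrib nat_power_eq)
qed

context
  fixes w :: nat and A :: "'a::linorder list"
  assumes w: "2 * length A + 2 \<le> 2 ^ w"
begin

text \<open>The list \<open>st\<close> is the stored stack, top first; its last \<open>b\<close> entries belong to finished
  blocks.\<close>

definition represents ::
  "nat \<Rightarrow> nat \<Rightarrow> nat \<Rightarrow> bool list \<Rightarrow> nat list \<Rightarrow> nat \<Rightarrow> config \<Rightarrow> bool" where
  "represents p B j out st b c \<longleftrightarrow>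
     pc c = p \<and> regs c 0 = length A \<and> regs c 1 = 1 \<and> regs c 2 = B \<and> regs c 3 = j \<and>
     regs c 4 = length out \<and> regs c 5 = length st \<and> regs c 6 = b \<and>
     regs c 10 = 2 * length A + 1 \<and> regs c 11 = 0 \<and>
     map (work c) [0..<length st] = rev st \<and>
     cells c \<le> length A div B + B \<and> outp c = stored out"

lemma map_upd_fresh: "map (f(length st := x)) [0..<length st] = map f [0..<length st]"
  by auto

lemma map_prefix:
  "map f [0..<length xs + length ys] = rev ys @ rev xs \<Longrightarrow> map f [0..<length ys] = rev ys"
  using upt_add_eq_append[of 0 "length ys" "length xs"]
  by (simp add: add.commute)

lemmas exec_simps = run_numeral length_cartesian_prog cartesian_prog_nth set_reg_def
  eval_Add eval_Sub stored_length stored_snoc represents_def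

lemma loop_exit:
  assumes "represents 11 B j out st b c" "length A \<le> j"
  shows "\<exists>c'. run w cartesian_prog A 2 c = Some c' \<and> represents 49 B j out st b c'"
  using assms by (simp add: exec_simps del: eval_binop.simps(1,2))

lemma loop_enter:
  assumes "represents 11 B j out st b c" "j < length A"
  shows "\<exists>c'. run w cartesian_prog A 2 c = Some c' \<and> represents 13 B j out st b c'"
  using assms by (simp add: exec_simps del: eval_binop.simps(1,2))

lemma pop_empty:
  assumes "represents 13 B j out [] b c"
  shows "\<exists>c'. run w cartesian_prog A (Suc 0) c = Some c' \<and> represents 36 B j out [] b c'"
  using assms by (simp add: exec_simps del: eval_binop.simps(1,2))

lemma pop_stop:
  assumes "represents 13 B j out (x # st) b c" "\<not> A ! j < A ! x"
    "j < length A" "x < length A" "length st < length A" "length st < length A div B + B"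
  shows "\<exists>c'. run w cartesian_prog A 5 c = Some c' \<and> represents 36 B j out (x # st) b c'"
  using assms w by (simp add: exec_simps del: eval_binop.simps(1,2))

lemma pop_current:
  assumes "represents 13 B j out (x # st) b c" "A ! j < A ! x" "b \<le> length st"
    "j < length A" "x < length A" "length st < length A" "length st < length A div B + B"
    "length out < 2 * length A + 1"
  shows "\<exists>c'. run w cartesian_prog A 11 c = Some c' \<and> represents 13 B j (out @ [False]) st b c'"
  using assms w by (simp add: exec_simps del: eval_binop.simps(1,2))

lemma pop_finished:
  assumes "represents 13 B j out (x # st) (Suc (length st)) c" "A ! j < A ! x"
    "j < length A" "x < length A" "length st < length A" "length st < length A div B + B"
    "length out < 2 * length A + 1"
  shows "\<exists>c'. run w cartesian_prog A 10 c = Some c' \<and>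
    represents 25 B j (out @ [False]) (x # st) (Suc (length st)) c' \<and>
    regs c' 7 = x \<and> regs c' 8 = x \<and> regs c' 12 = length st"
  using assms w by (simp add: exec_simps del: eval_binop.simps(1,2))

lemma scan_end:
  assumes "represents 25 B j out (x # st) b c"
    "regs c 7 = x" "regs c 8 = i" "regs c 12 = length st" "i mod B = 0"
  shows "\<exists>c'. run w cartesian_prog A 5 c = Some c' \<and> represents 13 B j out st (length st) c'"
  using assms by (simp add: exec_simps del: eval_binop.simps(1,2))

lemma scan_found:
  assumes "represents 25 B j out (x # st) b c"
    "regs c 7 = x" "regs c 8 = Suc i" "regs c 12 = length st" "Suc i mod B \<noteq> 0"
    "\<not> A ! x < A ! i" "i < x" "x < length A" "length st < length A div B + B"
  shows "\<exists>c'. run w cartesian_prog A 7 c = Some c' \<and> represents 13 B j out (i # st) b c'"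
  using assms w by (simp add: exec_simps map_upd_fresh del: eval_binop.simps(1,2))

lemma scan_continue:
  assumes "represents 25 B j out (x # st) b c"
    "regs c 7 = x" "regs c 8 = Suc i" "regs c 12 = length st" "Suc i mod B \<noteq> 0"
    "A ! x < A ! i" "i < x" "x < length A"
  shows "\<exists>c'. run w cartesian_prog A 6 c = Some c' \<and> represents 25 B j out (x # st) b c' \<and>
    regs c' 7 = x \<and> regs c' 8 = i \<and> regs c' 12 = length st"
  using assms w by (simp add: exec_simps del: eval_binop.simps(1,2))

lemma push:
  assumes "represents 36 B j out st b c" "Suc j mod B \<noteq> 0"
    "j < length A" "length st < length A" "length st < length A div B + B"
    "length out < 2 * length A + 1"
  shows "\<exists>c'. run w cartesian_prog A 8 c = Some c' \<and>
    represents 11 B (Suc j) (out @ [True]) (j # st) b c'"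
  using assms w by (simp add: exec_simps map_upd_fresh del: eval_binop.simps(1,2))

text \<open>The last position of a block is always pushed, hence it is the top of that block. It is
  stored right above the finished blocks, and \<open>cur\<close> is abandoned.\<close>

lemma push_finish_block:
  assumes "represents 36 B j out (cur @ old) (length old) c" "Suc j mod B = 0"
    "j < length A" "length (cur @ old) < length A" "length (cur @ old) < length A div B + B"
    "length out < 2 * length A + 1"
  shows "\<exists>c'. run w cartesian_prog A 12 c = Some c' \<and>
    represents 11 B (Suc j) (out @ [True]) (j # old) (Suc (length old)) c'"
  using assms w map_prefix[of "work c" cur old]
  by (simp add: exec_simps map_upd_fresh del: eval_binop.simps(1,2))

text \<open>The stack is not consulted: the total output length is known, and every remaining bit is
  a close. An iteration costs 5 instructions, the last one 3.\<close>

lemma finish: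
  assumes "pc c = 49" "regs c 1 = 1" "regs c 4 = length out" "regs c 10 = 2 * length A + 1"
    "regs c 11 = 0" "outp c = stored out" "length out + Suc m = 2 * length A + 2"
  shows "reaches_within w cartesian_prog A (5 * Suc m) c
    (\<lambda>c'. halted cartesian_prog c' \<and> outp c' = stored (out @ replicate (Suc m) False) \<and>
      cells c' = cells c)"
  using assms
proof (induction m arbitrary: c out)
  case 0
  then have "\<not> length out < 2 * length A + 1" by simp
  with 0(1-6) have "\<exists>c'. run w cartesian_prog A 3 c = Some c' \<and> pc c' = 54 \<and>
      outp c' = stored (out @ [False]) \<and> cells c' = cells c"
    by (simp add: exec_simps del: eval_binop.simps(1,2))
  then obtain c' where c': "run w cartesian_prog A 3 c = Some c'" "pc c' = 54"
      "outp c' = stored (out @ [False])" "cells c' = cells c"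
    by blast
  show ?case
    by (rule reaches_within_run[OF c'(1) reaches_within_refl[where k = 0]])
      (use c' in \<open>simp_all add: halted_def length_cartesian_prog cartesian_prog_nth\<close>)
next
  case (Suc m)
  then have "\<exists>c'. run w cartesian_prog A 5 c = Some c' \<and> pc c' = 49 \<and> regs c' 1 = 1 \<and>
      regs c' 4 = length (out @ [False]) \<and> regs c' 10 = 2 * length A + 1 \<and> regs c' 11 = 0 \<and>
      outp c' = stored (out @ [False]) \<and> cells c' = cells c"
    using w by (simp add: exec_simps del: eval_binop.simps(1,2))
  then obtain c' where c': "run w cartesian_prog A 5 c = Some c'" "pc c' = 49" "regs c' 1 = 1"
      "regs c' 4 = length (out @ [False])" "regs c' 10 = 2 * length A + 1" "regs c' 11 = 0"
      "outp c' = stored (out @ [False])" "cells c' = cells c"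
    by blast
  show ?case
    using Suc.IH[OF c'(2-7)] Suc.prems(7) c'(8) reaches_within_run[OF c'(1)] by simp
qed

text \<open>Moving left by one position takes at most 7 instructions and lowers
  \<open>i mod B\<close> by one, releasing 8 units. The offset of a found entry stays in the sum as
  credit for later scans; the summand 7 covers the exit at the block boundary.\<close>

lemma scan_finished_block:
  assumes "represents 25 B j out (block_tops B (x # old)) (length (block_tops B (x # old))) c"
    "regs c 7 = x" "regs c 8 = i" "regs c 12 = length (tl (block_tops B (x # old)))"
    "i \<le> x" "i div B = x div B" "\<forall>k\<in>{i..<x}. A ! x < A ! k"
  and old: "chain A (x # old)" "x < length A"
    "length (tl (block_tops B (x # old))) < length A div B + B"
  and cont: "\<And>c'. represents 13 B j out (block_tops B old) (length (block_tops B old)) c' \<Longrightarrow>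
    reaches_within w cartesian_prog A
      (K + 8 * sum_list (map (\<lambda>x. x mod B) (block_tops B old))) c' Q"
  shows "reaches_within w cartesian_prog A
    (K + 8 * (i mod B + sum_list (map (\<lambda>x. x mod B) (tl (block_tops B (x # old))))) + 7) c Q"
  using assms(1-7)
proof (induction i arbitrary: c rule: less_induct)
  case (less i)
  define st where "st = tl (block_tops B (x # old))"
  have st: "block_tops B (x # old) = x # st"
    by (simp add: st_def)
  note prems = less.prems[unfolded st list.sel]
  show ?case
  proof (cases "i mod B = 0")
    case True
    \<comment> \<open>An entry below \<open>x\<close> has a value at most \<open>A ! x\<close>, so
      it lies left of the scanned positions, hence before the start of the block.\<close>
    have "y div B \<noteq> x div B" if y: "y \<in> set old" for y
    proof -
      have "y < x" "A ! y \<le> A ! x" using old(1) y by auto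
      then have "y < i" using prems(7) by (meson atLeastLessThan_iff leD not_le)
      also have "i = x div B * B" using True prems(6) by (metis add.right_neutral div_mult_mod_eq)
      finally have "y div B < x div B" by (rule less_mult_imp_div_less)
      then show ?thesis by simp
    qed
    then have st': "block_tops B old = st"
      using block_tops_new_block[of old B x] by (simp add: st_def)
    obtain c' where c': "run w cartesian_prog A 5 c = Some c'"
      "represents 13 B j out st (length st) c'"
      using scan_end[OF prems(1-4) True] by blast
    show ?thesis
      using c'(2) True
      by (intro reaches_within_run[OF c'(1) cont]) (simp_all add: st st' del: block_tops.simps)
  next
    case False
    then obtain k where k: "i = Suc k" by (cases i) auto
    have div: "k div B = x div B" "Suc k mod B = Suc (k mod B)"
      using False prems(6) by (auto simp: k div_Suc mod_Suc split: if_splits)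
    have "k < x" using prems(5) k by simp
    show ?thesis
    proof (cases "A ! x < A ! k")
      case True
      have gap: "\<forall>i\<in>{k..<x}. A ! x < A ! i"
        using prems(7) True by (metis atLeastLessThan_iff k le_neq_implies_less Suc_leI)
      obtain c' where c': "run w cartesian_prog A 6 c = Some c'"
        "represents 25 B j out (x # st) (length (x # st)) c'"
        "regs c' 7 = x" "regs c' 8 = k" "regs c' 12 = length st"
        using scan_continue[OF prems(1,2) prems(3)[unfolded k] prems(4) False[unfolded k] True
            \<open>k < x\<close> old(2)] by blast
      have "reaches_within w cartesian_prog A
          (K + 8 * (k mod B + sum_list (map (\<lambda>x. x mod B) st)) + 7) c' Q"
        using less.IH[of k c'] c' gap div(1) \<open>k < x\<close> unfolding st by (simp add: k)
      then show ?thesis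
        by (rule reaches_within_run[OF c'(1)]) (simp add: k div(2) st del: block_tops.simps)
    next
      case neg: False
      have "\<forall>i\<in>{k<..<x}. A ! x < A ! i"
        using prems(7) k by auto
      then obtain s where "old = k # s"
        using chain_scan_found[OF old(1) \<open>k < x\<close> neg] by auto
      \<comment> \<open>\<open>k\<close> is in the block of \<open>x\<close>, so it merely replaces
        \<open>x\<close> as the kept top.\<close>
      then have st': "block_tops B old = k # st"
        using div(1) by (simp add: st_def)
      obtain c' where c': "run w cartesian_prog A 7 c = Some c'"
        "represents 13 B j out (k # st) (length (x # st)) c'"
        using scan_found[OF prems(1,2) prems(3)[unfolded k] prems(4) False[unfolded k] neg
            \<open>k < x\<close> old(2)] old(3)[folded st_def] by auto
      show ?thesis
        using c'(2) by (intro reaches_within_run[OF c'(1) cont])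
          (simp_all add: st st' k div(2) del: block_tops.simps)
    qed
  qed
qed

section \<open>Stack invariant and amortized running time\<close>

text \<open>\<open>cur @ old\<close> is the full stack, split at the start of the current block; the
  machine stores \<open>block_tops B old\<close> in place of \<open>old\<close>. The count
  \<open>2 * j + 1\<close> reflects \<open>j + 1\<close> opens and one close per popped
  position.\<close>

definition stack_inv ::
  "nat \<Rightarrow> bool list \<Rightarrow> nat \<Rightarrow> bool list \<Rightarrow> nat list \<Rightarrow> nat list \<Rightarrow> bool" where
  "stack_inv B xs j out cur old \<longleftrightarrow> chain A (cur @ old) \<and>
     set cur \<subseteq> {j div B * B..<j} \<and> set old \<subseteq> {..<j div B * B} \<and> j \<le> length A \<and>
     length out + length (cur @ old) = 2 * j + 1 \<and>
     stack_bp A [j..<length A] out (cur @ old) = xs"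

text \<open>There is one cell per finished block and one per stacked position of the current block.
  Strictness in the last bound leaves room for a push.\<close>

lemma stack_inv_length:
  assumes "stack_inv B xs j out cur old" "0 < B"
  shows "length (cur @ block_tops B old) \<le> j div B + j mod B"
    and "length (cur @ block_tops B old) \<le> j"
    and "j < length A \<Longrightarrow> length (cur @ block_tops B old) < length A div B + B"
proof -
  have chain: "chain A (cur @ old)" and cur: "set cur \<subseteq> {j div B * B..<j}"
    and old: "set old \<subseteq> {..<j div B * B}"
    using assms(1) by (simp_all add: stack_inv_def)
  have "length (block_tops B old) \<le> j div B"
    using chain_appendD[OF chain] old
    by (intro length_block_tops_le) (auto simp: less_mult_imp_div_less)
  moreover have "length cur \<le> j mod B"
    using card_mono[OF _ cur] chain_distinct[OF chain]
    by (simp add: distinct_card minus_div_mult_eq_mod)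
  ultimately show *: "length (cur @ block_tops B old) \<le> j div B + j mod B" by simp
  have "j div B \<le> j div B * B" using assms(2) by simp
  then show "length (cur @ block_tops B old) \<le> j"
    using * div_mult_mod_eq[of j B] by linarith
  show "length (cur @ block_tops B old) < length A div B + B" if "j < length A"
    using * mod_less_divisor[OF assms(2), of j] div_le_mono[of j "length A" B] that by linarith
qed

lemma stack_inv_below:
  assumes "stack_inv B xs j out cur old"
  shows "\<forall>y\<in>set (cur @ old). y < j"
proof -
  have "set cur \<subseteq> {..<j}" "set old \<subseteq> {..<j div B * B}"
    using assms by (auto simp: stack_inv_def)
  moreover have "{..<j div B * B} \<subseteq> {..<j}" by simp
  ultimately have "set (cur @ old) \<subseteq> {..<j}" by (metis Un_least order_trans set_append)
  then show ?thesis by auto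
qed

text \<open>The potential pays for the steps still to come: each output bit has a constant cost, and the
  scan of a finished block moves its stored top towards the start of the block. The summands
  \<open>j mod B\<close> and \<open>n - j\<close> save up for the scans of the current and of the later blocks.\<close>

definition potential :: "nat \<Rightarrow> nat \<Rightarrow> bool list \<Rightarrow> nat list \<Rightarrow> nat" where
  "potential B j out old = 20 * (2 * length A + 2 - length out) +
     8 * (j mod B + (length A - j)) + 8 * sum_list (map (\<lambda>x. x mod B) (block_tops B old))"

text \<open>The open parenthesis releases 20 units: at most 5 already spent on the pop test, at most
  12 for the push and 2 for the next loop test. At the end of a block the credit
  \<open>j mod B\<close> passes to the stored top \<open>j\<close>.\<close>

lemma push_step:
  assumes inv: "stack_inv B xs j out cur old" "0 < B" "j < length A"
    and stop: "cur @ old = [] \<or> \<not> A ! j < A ! hd (cur @ old)"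
    and gap: "\<forall>i<j. (\<forall>y\<in>set (cur @ old). y < i) \<longrightarrow> A ! j < A ! i"
    and rep: "represents 36 B j out (cur @ block_tops B old) (length (block_tops B old)) c"
    and cont: "\<And>out cur old c. stack_inv B xs (Suc j) out cur old \<Longrightarrow> j \<in> set (cur @ old) \<Longrightarrow>
      represents 11 B (Suc j) out (cur @ block_tops B old) (length (block_tops B old)) c \<Longrightarrow>
      reaches_within w cartesian_prog A (potential B (Suc j) out old + 2) c Q"
    and K: "potential B j out old \<le> K + 5"
  shows "reaches_within w cartesian_prog A K c Q"
proof -
  have chain: "chain A (cur @ old)" and cur: "set cur \<subseteq> {j div B * B..<j}"
    and old: "set old \<subseteq> {..<j div B * B}"
    and len: "length out + length (cur @ old) = 2 * j + 1"
    and bp: "stack_bp A [j..<length A] out (cur @ old) = xs"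
    using inv(1) by (simp_all add: stack_inv_def)
  note below = stack_inv_below[OF inv(1)]
  have chain': "chain A (j # cur @ old)"
    using chain_push[OF chain stop below gap] .
  have bp': "stack_bp A [Suc j..<length A] (out @ [True]) (j # cur @ old) = xs"
    using stack_bp_pop_all[of "[]" A j "cur @ old" "[Suc j..<length A]" out] stop bp inv(3)
    by (simp add: upt_conv_Cons not_less)
  have small: "length (cur @ block_tops B old) < length A"
      "length (cur @ block_tops B old) < length A div B + B" "length out < 2 * length A + 1"
    using stack_inv_length[OF inv(1,2)] inv(3) len by auto
  have block: "j div B * B \<le> j" "j < Suc (j div B) * B"
    using inv(2) by (simp_all add: dividend_less_div_times)
  show ?thesis
  proof (cases "Suc j mod B = 0")
    case False
    then have div: "Suc j div B = j div B" "Suc j mod B = Suc (j mod B)"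
      by (auto simp: div_Suc mod_Suc split: if_splits)
    obtain c' where c': "run w cartesian_prog A 8 c = Some c'"
      "represents 11 B (Suc j) (out @ [True]) ((j # cur) @ block_tops B old)
        (length (block_tops B old)) c'"
      using push[OF rep False inv(3) small] by auto
    have inv': "stack_inv B xs (Suc j) (out @ [True]) (j # cur) old"
      using chain' bp' cur old block len inv(3) unfolding stack_inv_def div by (auto simp: subset_iff less_Suc_eq)
    show ?thesis
      by (rule reaches_within_run[OF c'(1) cont[OF inv' _ c'(2)]])
        (use K small(3) inv(3) div(2) in \<open>simp_all add: potential_def\<close>)
  next
    case True
    then have div: "Suc j div B * B = Suc j"
      by (metis add.right_neutral div_mult_mod_eq)
    have tops: "block_tops B ((j # cur) @ old) = j # block_tops B old"
    proof (subst block_tops_append)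
      show "\<forall>x\<in>set (j # cur). x div B = j div B"
        using cur block(2) by (auto intro!: div_nat_eqI simp: mult.commute)
      show "\<forall>y\<in>set old. y div B \<noteq> j div B"
        using old by (auto dest!: subsetD less_mult_imp_div_less)
    qed simp_all
    obtain c' where c': "run w cartesian_prog A 12 c = Some c'"
      "represents 11 B (Suc j) (out @ [True]) ([] @ block_tops B ((j # cur) @ old))
        (length (block_tops B ((j # cur) @ old))) c'"
      using push_finish_block[OF rep True inv(3) small] unfolding tops by auto
    have inv': "stack_inv B xs (Suc j) (out @ [True]) [] ((j # cur) @ old)"
      using chain' bp' below len inv(3) unfolding stack_inv_def div by (auto simp: less_Suc_eq)
    show ?thesis
      by (rule reaches_within_run[OF c'(1) cont[OF inv' _ c'(2)]])
        (use K small(3) inv(3) True tops in \<open>simp_all add: potential_def\<close>)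
  qed
qed

text \<open>Induction on the height of the full stack. The gap condition survives every pop and is
  what \<open>chain\<close> requires when \<open>j\<close> is finally pushed; \<open>cont\<close>
  stands for the rest of the main loop.\<close>

lemma pop_loop:
  assumes "0 < B" "j < length A"
    and cont: "\<And>out cur old c. stack_inv B xs (Suc j) out cur old \<Longrightarrow> j \<in> set (cur @ old) \<Longrightarrow>
      represents 11 B (Suc j) out (cur @ block_tops B old) (length (block_tops B old)) c \<Longrightarrow>
      reaches_within w cartesian_prog A (potential B (Suc j) out old + 2) c Q"
    and "stack_inv B xs j out cur old"
      "\<forall>i<j. (\<forall>y\<in>set (cur @ old). y < i) \<longrightarrow> A ! j < A ! i"
      "represents 13 B j out (cur @ block_tops B old) (length (block_tops B old)) c"
  shows "reaches_within w cartesian_prog A (potential B j out old) c Q"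
  using assms(4-6)
proof (induction "length (cur @ old)" arbitrary: out cur old c rule: less_induct)
  case less
  note inv = less.prems(1) and gap = less.prems(2) and rep = less.prems(3)
  have chain: "chain A (cur @ old)" and cur: "set cur \<subseteq> {j div B * B..<j}"
    and old: "set old \<subseteq> {..<j div B * B}"
    and len: "length out + length (cur @ old) = 2 * j + 1"
    and bp: "stack_bp A [j..<length A] out (cur @ old) = xs"
    using inv by (simp_all add: stack_inv_def)
  note below = stack_inv_below[OF inv]
  have small: "length (cur @ block_tops B old) < length A"
      "length (cur @ block_tops B old) < length A div B + B" "length out < 2 * length A + 1"
    using stack_inv_length[OF inv assms(1)] assms(2) len by auto
  \<comment> \<open>The bit written pays for a pop: at most 11 instructions, or 10 plus the extra 7
    of a scan.\<close>
  have pot: "potential B j (out @ [False]) s + 20 = potential B j out s" for s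
    using small(3) by (simp add: potential_def)
  show ?case
  proof (cases "cur @ old")
    case Nil
    then obtain c' where c': "run w cartesian_prog A (Suc 0) c = Some c'"
      "represents 36 B j out (cur @ block_tops B old) (length (block_tops B old)) c'"
      using pop_empty[of B j out _ c] rep by auto
    have "reaches_within w cartesian_prog A (potential B j out old - Suc 0) c' Q"
      by (rule push_step[OF inv assms(1,2) _ gap c'(2) cont]) (use Nil in auto)
    then show ?thesis
      by (rule reaches_within_run[OF c'(1)]) (use small(3) in \<open>simp add: potential_def\<close>)
  next
    case (Cons x s)
    have x: "x < length A" using below Cons assms(2) by force
    obtain st where st: "cur @ block_tops B old = x # st"
      using Cons by (cases cur) auto
    note rep' = rep[unfolded st]
    have small': "length st < length A" "length st < length A div B + B"
      using small unfolding st by auto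
    show ?thesis
    proof (cases "A ! j < A ! x")
      case False
      obtain c' where c': "run w cartesian_prog A 5 c = Some c'"
        "represents 36 B j out (cur @ block_tops B old) (length (block_tops B old)) c'"
        using pop_stop[OF rep' False assms(2) x small'] unfolding st by auto
      have "reaches_within w cartesian_prog A (potential B j out old - 5) c' Q"
        by (rule push_step[OF inv assms(1,2) _ gap c'(2) cont]) (use Cons False in auto)
      then show ?thesis
        by (rule reaches_within_run[OF c'(1)]) (use small(3) in \<open>simp add: potential_def\<close>)
    next
      case True
      have bp': "stack_bp A [j..<length A] (out @ [False]) s = xs"
        using bp True assms(2) unfolding Cons by (simp add: upt_conv_Cons)
      \<comment> \<open>Positions left of \<open>x\<close> exposed by the pop have values above
        \<open>A ! x\<close> by the chain property, and \<open>A ! x\<close> is above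
        \<open>A ! j\<close>.\<close>
      have gap': "\<forall>i<j. (\<forall>y\<in>set s. y < i) \<longrightarrow> A ! j < A ! i"
      proof (intro allI impI)
        fix i assume i: "i < j" "\<forall>y\<in>set s. y < i"
        consider "i < x" | "i = x" | "x < i" by linarith
        then show "A ! j < A ! i"
        proof cases
          case 1
          then have "A ! x < A ! i" using chain i(2) unfolding Cons by simp
          then show ?thesis using True by simp
        next
          case 3
          then show ?thesis using gap i unfolding Cons by simp
        qed (use True in simp)
      qed
      show ?thesis
      proof (cases cur)
        case cur': (Cons y cur')
        have s: "y = x" "s = cur' @ old" "st = cur' @ block_tops B old"
          using Cons st cur' by auto
        obtain c' where c': "run w cartesian_prog A 11 c = Some c'"
          "represents 13 B j (out @ [False]) (cur' @ block_tops B old) (length (block_tops B old)) c'"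
          using pop_current[OF rep' True _ assms(2) x small' small(3)] unfolding s by auto
        have inv': "stack_inv B xs j (out @ [False]) cur' old"
          using inv bp' cur' s unfolding stack_inv_def by auto
        have "reaches_within w cartesian_prog A (potential B j (out @ [False]) old) c' Q"
          by (rule less.hyps[OF _ inv' _ c'(2)]) (use gap' s cur' in auto)
        then show ?thesis
          by (rule reaches_within_run[OF c'(1)]) (use pot[of old] in simp)
      next
        case Nil
        have s: "old = x # s" "block_tops B (x # s) = x # st"
          using Cons st Nil by auto
        have st_len: "length (block_tops B old) = Suc (length st)" using s by simp
        obtain c' where c': "run w cartesian_prog A 10 c = Some c'"
          "represents 25 B j (out @ [False]) (x # st) (Suc (length st)) c'"
          "regs c' 7 = x" "regs c' 8 = x" "regs c' 12 = length st"
          using pop_finished[OF rep'[unfolded st_len] True assms(2) x small' small(3)] by blast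
        have inv': "stack_inv B xs j (out @ [False]) [] s"
          using inv bp' s Nil unfolding stack_inv_def by auto
        \<comment> \<open>\<open>K\<close> is the part of the potential that the scan leaves
          unchanged.\<close>
        define K where "K = 20 * (2 * length A + 2 - length (out @ [False])) +
          8 * (j mod B + (length A - j))"
        have K: "potential B j (out @ [False]) r =
            K + 8 * sum_list (map (\<lambda>x. x mod B) (block_tops B r))" for r
          by (simp add: potential_def K_def)
        have "reaches_within w cartesian_prog A
          (K + 8 * (x mod B + sum_list (map (\<lambda>x. x mod B) (tl (block_tops B (x # s))))) + 7) c' Q"
        proof (rule scan_finished_block)
          show "represents 25 B j (out @ [False]) (block_tops B (x # s))
            (length (block_tops B (x # s))) c'"
            using c'(2) by (simp only: s(2) list.size) simp
          show "chain A (x # s)" using chain Nil s(1) by simp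
          show "reaches_within w cartesian_prog A
              (K + 8 * sum_list (map (\<lambda>x. x mod B) (block_tops B s))) d Q"
            if "represents 13 B j (out @ [False]) (block_tops B s) (length (block_tops B s)) d" for d
            unfolding K[symmetric]
            by (rule less.hyps[OF _ inv']) (use gap' s(1) Nil that in auto)
        qed (use c' s(2) x small' in auto)
        then show ?thesis
          by (rule reaches_within_run[OF c'(1)])
            (use pot[of old] K[of old] s in \<open>simp del: block_tops.simps\<close>)
      qed
    qed
  qed
qed

text \<open>With \<open>j - 1\<close> on the stack no earlier position lies above all entries, so
  the gap condition of \<open>pop_loop\<close> holds vacuously. The extra 2 pays for the loop
  test.\<close>

lemma main_loop:
  assumes "0 < B" "stack_inv B xs j out cur old" "0 < j \<Longrightarrow> j - 1 \<in> set (cur @ old)"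
    "represents 11 B j out (cur @ block_tops B old) (length (block_tops B old)) c"
  shows "reaches_within w cartesian_prog A (potential B j out old + 2) c
    (\<lambda>c'. halted cartesian_prog c' \<and> outp c' = stored xs \<and> cells c' \<le> length A div B + B)"
  using assms(2-4)
proof (induction "length A - j" arbitrary: j out cur old c)
  case 0
  then have j: "j = length A" by (simp add: stack_inv_def)
  have len: "length out + length (cur @ old) = 2 * length A + 1"
    and xs: "xs = out @ replicate (Suc (length (cur @ old))) False"
    using 0(2) unfolding stack_inv_def j by auto
  obtain c' where c': "run w cartesian_prog A 2 c = Some c'"
    "represents 49 B j out (cur @ block_tops B old) (length (block_tops B old)) c'"
    using loop_exit[OF 0(4)] j by auto
  have "reaches_within w cartesian_prog A (5 * Suc (length (cur @ old))) c'
    (\<lambda>d. halted cartesian_prog d \<and> outp d = stored xs \<and> cells d = cells c')"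
    unfolding xs by (rule finish) (use c'(2) len in \<open>auto simp: represents_def\<close>)
  then have "reaches_within w cartesian_prog A (5 * Suc (length (cur @ old))) c'
    (\<lambda>c'. halted cartesian_prog c' \<and> outp c' = stored xs \<and> cells c' \<le> length A div B + B)"
    by (rule reaches_within_weaken) (use c'(2) in \<open>simp add: represents_def\<close>)
  then show ?case
    by (rule reaches_within_run[OF c'(1)]) (use len in \<open>simp add: potential_def\<close>)
next
  case (Suc k)
  then have j: "j < length A" "k = length A - Suc j" by auto
  obtain c' where c': "run w cartesian_prog A 2 c = Some c'"
    "represents 13 B j out (cur @ block_tops B old) (length (block_tops B old)) c'"
    using loop_enter[OF Suc(5) j(1)] by auto
  have gap: "\<forall>i<j. (\<forall>y\<in>set (cur @ old). y < i) \<longrightarrow> A ! j < A ! i"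
    using Suc(4) by fastforce
  have "reaches_within w cartesian_prog A (potential B j out old) c'
    (\<lambda>c'. halted cartesian_prog c' \<and> outp c' = stored xs \<and> cells c' \<le> length A div B + B)"
    by (rule pop_loop[OF assms(1) j(1) _ Suc(3) gap c'(2)]) (rule Suc(1)[OF j(2)], auto)
  then show ?case
    by (rule reaches_within_run[OF c'(1)]) simp
qed

section \<open>Finding the block length, and the overall bounds\<close>

text \<open>The crude bound of \<open>length A - B\<close> further iterations suffices for linear
  time. The disjunction records that the previous candidate was too small.\<close>

lemma block_length_loop:
  assumes "pc c = 2" "regs c 0 = length A" "regs c 1 = 1" "regs c 2 = B" "regs c 3 = 0"
    "regs c 4 = 0" "regs c 5 = 0" "regs c 6 = 0" "regs c 11 = 0" "cells c = 0"
    "outp c = stored []" "0 < B" "B = 1 \<or> (B - 1) * (B - 1) < length A"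
  and cont: "\<And>B c'. 0 < B \<Longrightarrow> length A \<le> B * B \<Longrightarrow> B = 1 \<or> (B - 1) * (B - 1) < length A \<Longrightarrow>
    represents 11 B 0 [True] [] 0 c' \<Longrightarrow> reaches_within w cartesian_prog A K c' Q"
  shows "reaches_within w cartesian_prog A (5 * (length A - B) + 7 + K) c Q"
  using assms(1-13)
proof (induction "length A - B" arbitrary: B c rule: less_induct)
  case less
  have BB: "B * B < 2 ^ w"
  proof -
    obtain b where b: "B = Suc b" using less.prems(12) by (cases B) auto
    \<comment> \<open>If \<open>b * b < length A\<close>, this gives
      \<open>(b + 1) * (b + 1) \<le> 2 * (b * b + 1) < 2 ^ w\<close>, so squaring does not
      overflow.\<close>
    have "2 * b \<le> b * b + 1" by (cases b) (auto simp: algebra_simps)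
    then show ?thesis using less.prems(13) w by (auto simp: b)
  qed
  have B: "B \<le> B * B" by simp
  show ?case
  proof (cases "B * B < length A")
    case True
    have "B < length A" using True B by linarith
    moreover have "B + 1 < 2 ^ w" using True B w by linarith
    ultimately have "\<exists>c'. run w cartesian_prog A 5 c = Some c' \<and>
      pc c' = 2 \<and> regs c' 0 = length A \<and> regs c' 1 = 1 \<and> regs c' 2 = B + 1 \<and> regs c' 3 = 0 \<and>
      regs c' 4 = 0 \<and> regs c' 5 = 0 \<and> regs c' 6 = 0 \<and> regs c' 11 = 0 \<and> cells c' = 0 \<and>
      outp c' = stored []"
      using True less.prems(1-11) BB by (simp add: exec_simps del: eval_binop.simps(1,2))
    then obtain c' where c': "run w cartesian_prog A 5 c = Some c'"
      "pc c' = 2" "regs c' 0 = length A" "regs c' 1 = 1" "regs c' 2 = B + 1" "regs c' 3 = 0"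
      "regs c' 4 = 0" "regs c' 5 = 0" "regs c' 6 = 0" "regs c' 11 = 0" "cells c' = 0"
      "outp c' = stored []"
      by blast
    have "reaches_within w cartesian_prog A (5 * (length A - (B + 1)) + 7 + K) c' Q"
      by (rule less.hyps[OF _ c'(2-12)]) (use True \<open>B < length A\<close> in auto)
    then show ?thesis
      by (rule reaches_within_run[OF c'(1)]) (use True \<open>B < length A\<close> in auto)
  next
    case False
    then have "\<exists>c'. run w cartesian_prog A 7 c = Some c' \<and> represents 11 B 0 [True] [] 0 c'"
      using less.prems(1-11) BB w stored_length[of "[]"] stored_snoc[of "[]" True]
      by (simp add: exec_simps del: eval_binop.simps(1,2))
    then obtain c' where c': "run w cartesian_prog A 7 c = Some c'" "represents 11 B 0 [True] [] 0 c'"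
      by blast
    show ?thesis
      using False less.prems(12,13) by (intro reaches_within_run[OF c'(1) cont[OF _ _ _ c'(2)]]) auto
  qed
qed

text \<open>The coefficient 53 is \<open>20 * 2 + 8\<close> from the initial potential plus 5 for
  finding \<open>B\<close>. For space, \<open>length A \<le> B * B\<close> gives
  \<open>length A div B \<le> B\<close>, and the rejected \<open>B - 1\<close> gives
  \<open>B \<le> sqrt (length A) + 1\<close>.\<close>

lemma cartesian_prog_correct:
  "reaches_within w cartesian_prog A (53 * length A + 36) (init_config (length A))
    (\<lambda>c. halted cartesian_prog c \<and> outp c = stored (bp (tau4 (cartesian_tree A))) \<and>
      real (cells c) \<le> 2 * sqrt (length A) + 2)"
    (is "reaches_within _ _ _ _ _ ?Q")
proof -
  let ?c = "init_config (length A)"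
  have 1: "1 < (2::nat) ^ w" using w by linarith
  then have "0 < w" by (cases w) auto
  have "\<exists>c'. run w cartesian_prog A 2 ?c = Some c' \<and> pc c' = 2 \<and> regs c' 0 = length A \<and>
      regs c' 1 = 1 \<and> regs c' 2 = 1 \<and> regs c' 3 = 0 \<and>
      regs c' 4 = 0 \<and> regs c' 5 = 0 \<and> regs c' 6 = 0 \<and> regs c' 11 = 0 \<and> cells c' = 0 \<and>
      outp c' = stored []"
    using 1 \<open>0 < w\<close> by (simp add: exec_simps init_config_def stored_def del: eval_binop.simps(1,2))
  then obtain c' where c': "run w cartesian_prog A 2 ?c = Some c'" "pc c' = 2"
    "regs c' 0 = length A" "regs c' 1 = 1" "regs c' 2 = 1" "regs c' 3 = 0" "regs c' 4 = 0"
    "regs c' 5 = 0" "regs c' 6 = 0" "regs c' 11 = 0" "cells c' = 0" "outp c' = stored []"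
    by blast
  have "reaches_within w cartesian_prog A (48 * length A + 22) d ?Q"
    if B: "0 < B" "length A \<le> B * B" "B = 1 \<or> (B - 1) * (B - 1) < length A"
      and d: "represents 11 B 0 [True] [] 0 d" for B d
  proof -
    have "stack_inv B (bp (tau4 (cartesian_tree A))) 0 [True] [] []"
      by (simp add: stack_inv_def stack_bp_eq_bp)
    from main_loop[OF B(1) this _, of d]
    have reach: "reaches_within w cartesian_prog A (48 * length A + 22) d
      (\<lambda>c. halted cartesian_prog c \<and> outp c = stored (bp (tau4 (cartesian_tree A))) \<and>
        cells c \<le> length A div B + B)"
      using d by (simp add: potential_def add.commute)
    have "length A div B \<le> B"
      using B(1,2) by (metis div_le_mono div_mult_self_is_m)
    moreover have "real B \<le> sqrt (length A) + 1"
    proof (cases "B = 1")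
      case False
      then have "real ((B - 1) * (B - 1)) \<le> length A" using B(3) by (simp only: of_nat_le_iff) simp
      then have "real (B - 1) \<le> sqrt (length A)"
        by (intro real_le_rsqrt) (simp add: power2_eq_square)
      then show ?thesis using B(1) by (simp add: of_nat_diff)
    qed simp
    ultimately have "real m \<le> 2 * sqrt (length A) + 2" if "m \<le> length A div B + B" for m
      using that by (smt (verit) of_nat_add of_nat_le_iff)
    then show ?thesis using reaches_within_weaken[OF reach] by simp
  qed
  from block_length_loop[OF c'(2-12) _ _ this]
  have "reaches_within w cartesian_prog A (5 * (length A - 1) + 7 + (48 * length A + 22)) c' ?Q"
    by simp
  then show ?thesis
    by (rule reaches_within_run[OF c'(1)]) simp
qed

end

theorem theorem5:
  "\<exists>P :: prog. \<forall>w :: nat \<Rightarrow> nat. word_size w \<longrightarrow>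
     (\<exists>(T :: nat \<Rightarrow> nat) (S :: nat \<Rightarrow> nat).
        (\<lambda>n. real (T n)) \<in> O(\<lambda>n. real n) \<and>
        (\<lambda>n. real (S n)) \<in> O(\<lambda>n. sqrt (real n) * log 2 (real n)) \<and>
        (\<forall>A :: 'a::linorder list. \<exists>t s.
           computes (w (length A)) P A (bp (tau4 (cartesian_tree A))) t s \<and>
           t \<le> T (length A) \<and> s \<le> S (length A)))"
proof (intro exI[of _ cartesian_prog] allI impI)
  fix w :: "nat \<Rightarrow> nat"
  assume w: "word_size w"
  define r where "r = card (registers cartesian_prog)"
  define T where "T n = 53 * n + 36" for n :: nat
  \<comment> \<open>The floor turns the real bound on the cells into a natural number depending on
    \<open>n\<close> alone.\<close>
  define M where "M n = nat \<lfloor>2 * sqrt (real n) + 2\<rfloor>" for n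
  have M: "m \<le> M n \<longleftrightarrow> real m \<le> 2 * sqrt (real n) + 2" for m n
  proof -
    have "0 \<le> \<lfloor>2 * sqrt (real n) + 2\<rfloor>" by simp
    then show ?thesis unfolding M_def by (simp only: le_nat_iff le_floor_iff of_int_of_nat_eq)
  qed
  define S where "S n = (r + M n) * w n" for n
  have "(\<lambda>n. real (T n)) \<in> O(\<lambda>n. real n)"
  \<comment> \<open>\<open>89 = 53 + 36\<close>, using \<open>n \<ge> 1\<close>.\<close>
  proof (rule bigoI[of _ 89])
    show "\<forall>\<^sub>F n in sequentially. norm (real (T n)) \<le> 89 * norm (real n)"
      using eventually_ge_at_top[of 1] by eventually_elim (simp add: T_def)
  qed
  moreover have "(\<lambda>n. real (S n)) \<in> O(\<lambda>n. sqrt (real n) * log 2 (real n))"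
  proof -
    have "(\<lambda>n. real (r + M n)) \<in> O(\<lambda>n. sqrt (real n))"
    \<comment> \<open>For \<open>n \<ge> 1\<close> the constants \<open>r\<close> and 2 are at most
      \<open>r\<close> and 2 times \<open>sqrt n\<close>.\<close>
    proof (rule bigoI[of _ "r + 4"])
      show "\<forall>\<^sub>F n in sequentially. norm (real (r + M n)) \<le> (r + 4) * norm (sqrt (real n))"
        using eventually_ge_at_top[of 1]
      proof eventually_elim
        case (elim n)
        then have 1: "1 \<le> sqrt (real n)" by simp
        have "real (M n) \<le> 2 * sqrt (real n) + 2" using M by blast
        moreover have "real r \<le> r * sqrt (real n)" using 1 by (simp add: mult_le_cancel_left1)
        ultimately have "real (r + M n) \<le> (real r + 4) * sqrt (real n)"
          using 1 by (simp only: of_nat_add distrib_right)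
        then show ?case by simp
      qed
    qed
    moreover have "(\<lambda>n. real (w n)) \<in> O(\<lambda>n. log 2 (real n))"
      using w by (auto simp: word_size_def)
    ultimately show ?thesis
      unfolding S_def of_nat_mult by (rule landau_o.big.mult)
  qed
  moreover have "\<exists>t s. computes (w (length A)) cartesian_prog A (bp (tau4 (cartesian_tree A))) t s \<and>
      t \<le> T (length A) \<and> s \<le> S (length A)" for A :: "'a list"
  proof -
    have "2 * length A + 2 \<le> 2 ^ w (length A)"
      using w by (simp add: word_size_def)
    from cartesian_prog_correct[OF this] obtain t c where c: "t \<le> T (length A)"
      "(step (w (length A)) cartesian_prog A ^^ t) (init_config (length A)) c"
      "halted cartesian_prog c" "outp c = stored (bp (tau4 (cartesian_tree A)))"
      "cells c \<le> M (length A)"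
      by (auto simp: reaches_within_def T_def M)
    then show ?thesis
      by (intro exI[of _ t] exI[of _ "space_bits (w (length A)) cartesian_prog c"])
        (auto simp: computes_def stored_def space_bits_def S_def r_def)
  qed
  ultimately show "\<exists>T S. (\<lambda>n. real (T n)) \<in> O(\<lambda>n. real n) \<and>
      (\<lambda>n. real (S n)) \<in> O(\<lambda>n. sqrt (real n) * log 2 (real n)) \<and>
      (\<forall>A :: 'a list. \<exists>t s.
        computes (w (length A)) cartesian_prog A (bp (tau4 (cartesian_tree A))) t s \<and>
        t \<le> T (length A) \<and> s \<le> S (length A))"
    by blast
qed

end
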